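(* Let $G$ be a forest with $q$ edges. Let $K_q$ be the complete graph on $q$ vertices, each labeled with an edge of $G$ (distinct vertices being labeled with distinct edges). Let $K'$ be the subgraph of $K_q$ obtained by removing from $K_q$ all edges $\{e,e'\}$ where $e$ and $e'$ are edges of $G$ with $\mathrm{dist}_G(e,e')=1$. Then $\mathrm{Scarf}(G)$ is the clique complex of $K'$.
   Context: Graphs are finite and simple; the vertices of $G$ are identified with variables of a polynomial ring over a field, and an edge $\{x,y\}$ with the monomial $xy$. $\mathrm{Taylor}(G)$ is the full simplex whose vertices are the edges of $G$ (the minimal generators of the edge ideal $I(G)=(xy\mid \{x,y\}\in E(G))$). Its faces are all subsets $\sigma\subseteq E(G)$, including $\varnothing$, and $\sigma$ is labeled by the monomial $\mathbf m_\sigma=\mathrm{lcm}(e: e\in\sigma)$ (with $\mathbf m_\varnothing=1$). $\mathrm{Scarf}(G)$ is the subcomplex of all faces of $\mathrm{Taylor}(G)$ whose label is not the label of any other face of $\mathrm{Taylor}(G)$. For edges $e,e'$ of $G$, $\mathrm{dist}_G(e,e')$ is the minimum number of edges of a path in $G$ connecting a vertex of $e$ to a vertex of $e'$ ($0$ if they share a vertex, $\infty$ if there is no such path). The clique complex of a graph is the simplicial complex whose faces are the sets of pairwise adjacent vertices. *)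

theory Defs
  imports "HOL-Library.Multiset" "HOL-Library.Extended_Nat"
begin

type_synonym 'v graph = "'v set \<times> 'v set set"

abbreviation verts :: "'v graph \<Rightarrow> 'v set" where "verts \<equiv> fst"
abbreviation edges :: "'v graph \<Rightarrow> 'v set set" where "edges \<equiv> snd"

definition finite_simple_graph :: "'v graph \<Rightarrow> bool" where
  "finite_simple_graph G \<longleftrightarrow>
     finite (verts G) \<and> (\<forall>e \<in> edges G. e \<subseteq> verts G \<and> card e = 2)"

text \<open>A path is given by its nonempty list of pairwise distinct vertices; it has one edge fewer
  than it has vertices.\<close>

definition is_path :: "'v graph \<Rightarrow> 'v list \<Rightarrow> bool" where
  "is_path G p \<longleftrightarrow> p \<noteq> [] \<and> distinct p \<and> set p \<subseteq> verts G \<and>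
     (\<forall>i. Suc i < length p \<longrightarrow> {p ! i, p ! Suc i} \<in> edges G)"

definition is_cycle :: "'v graph \<Rightarrow> 'v list \<Rightarrow> bool" where
  "is_cycle G p \<longleftrightarrow> is_path G p \<and> 3 \<le> length p \<and> {last p, hd p} \<in> edges G"

definition forest :: "'v graph \<Rightarrow> bool" where
  "forest G \<longleftrightarrow> finite_simple_graph G \<and> (\<nexists>p. is_cycle G p)"

text \<open>In the type \<^typ>\<open>enat\<close> the infimum of a nonempty set is its minimum, and the infimum of the
  empty set is \<^term>\<open>\<infinity> :: enat\<close>, as wanted when no path exists.\<close>

definition edge_dist :: "'v graph \<Rightarrow> 'v set \<Rightarrow> 'v set \<Rightarrow> enat" where
  "edge_dist G e e' =
     Inf {enat (length p - 1) | p. is_path G p \<and> hd p \<in> e \<and> last p \<in> e'}"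

definition complete_graph :: "'v set \<Rightarrow> 'v graph" where
  "complete_graph S = (S, {e. e \<subseteq> S \<and> card e = 2})"

definition remove_edges :: "'v graph \<Rightarrow> 'v set set \<Rightarrow> 'v graph" where
  "remove_edges G F = (verts G, edges G - F)"

text \<open>A simplicial complex is represented by its set of faces, the empty face included.\<close>

definition clique_complex :: "'v graph \<Rightarrow> 'v set set" where
  "clique_complex G =
     {\<sigma>. finite \<sigma> \<and> \<sigma> \<subseteq> verts G \<and> (\<forall>u \<in> \<sigma>. \<forall>v \<in> \<sigma>. u \<noteq> v \<longrightarrow> {u, v} \<in> edges G)}"

definition Taylor :: "'v graph \<Rightarrow> 'v set set set" where
  "Taylor G = Pow (edges G)"

text \<open>A monomial in the variables \<^typ>\<open>'v\<close> is represented by the multiset of its variables, so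
  that multiplication is \<open>+\<close>, divisibility is \<open>\<subseteq>#\<close>, the monomial 1 is \<open>{#}\<close>, and least common
  multiples are suprema for \<open>\<subseteq>#\<close> (maxima of exponents). The coefficient field plays no role.\<close>

type_synonym 'v monomial = "'v multiset"

definition edge_monomial :: "'v set \<Rightarrow> 'v monomial" where
  "edge_monomial e = mset_set e"

definition label :: "'v set set \<Rightarrow> 'v monomial" where
  "label \<sigma> = Sup (edge_monomial ` \<sigma>)"

definition Scarf :: "'v graph \<Rightarrow> 'v set set set" where
  "Scarf G = {\<sigma> \<in> Taylor G. \<forall>\<tau> \<in> Taylor G. label \<tau> = label \<sigma> \<longrightarrow> \<tau> = \<sigma>}"

lemma edge_monomial_pair: "x \<noteq> y \<Longrightarrow> edge_monomial {x, y} = {#x, y#}"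
  by (simp add: edge_monomial_def)

lemma label_empty: "label {} = {#}"
  by (simp add: label_def Sup_multiset_empty)

lemma label_dvd_iff:
  assumes "finite \<sigma>"
  shows "label \<sigma> \<subseteq># m \<longleftrightarrow> (\<forall>e \<in> \<sigma>. edge_monomial e \<subseteq># m)"
proof (cases "\<sigma> = {}")
  case False
  have "subset_mset.bdd_above (edge_monomial ` \<sigma>)"
    using assms by (simp add: subset_mset.bdd_above_finite)
  then show ?thesis
    using False by (simp add: label_def subset_mset.cSup_le_iff)
qed (simp add: label_empty)

end

theory Submission imports Defs begin

text \<open>The monomials in question are squarefree, so a label is the same thing as the set of
  vertices it involves: \<open>label \<sigma> = label \<tau>\<close> means that the edge sets \<open>\<sigma>\<close> and \<open>\<tau>\<close> cover the same
  vertices (lemma \<open>label_eq_iff\<close>). Hence \<open>\<sigma>\<close> fails to be a Scarf face exactly when it can be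
  exchanged for another edge set covering the same vertices, and this can be tested one edge at a
  time. Call an edge \<open>f\<close> redundant for an edge set \<open>\<rho>\<close> not containing it if both ends of \<open>f\<close> are
  covered by \<open>\<rho>\<close>: adding \<open>f\<close> to \<open>\<rho>\<close> does not change the label.

  If two edges \<open>{a, b}\<close> and \<open>{c, d}\<close> of \<open>\<sigma>\<close> are at distance 1, say because \<open>{b, c}\<close> is an edge,
  then \<open>{b, c}\<close> can be inserted into or deleted from \<open>\<sigma>\<close> without changing its label, so \<open>\<sigma>\<close> is not a
  Scarf face. Conversely, if \<open>\<tau> \<noteq> \<sigma>\<close> covers the same vertices as \<open>\<sigma>\<close>, then some edge is
  redundant for a subset of \<open>\<sigma>\<close>: an edge of \<open>\<tau> - \<sigma>\<close> is redundant for \<open>\<sigma>\<close>, and if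
  \<open>\<tau> \<subset> \<sigma>\<close>, an edge of \<open>\<sigma> - \<tau>\<close> is redundant for \<open>\<tau>\<close>. The two ends of a redundant edge are
  covered by two different edges; these are disjoint, since otherwise the three edges would form a
  triangle, and so they are at distance 1 (lemma \<open>redundant_edge_imp_dist_1\<close>).\<close>

lemma edge_monomial_dvd_iff:
  assumes "finite e"
  shows "edge_monomial e \<subseteq># m \<longleftrightarrow> e \<subseteq> set_mset m"
proof
  assume "edge_monomial e \<subseteq># m"
  then show "e \<subseteq> set_mset m"
    using assms set_mset_mono by (fastforce simp: edge_monomial_def)
next
  assume "e \<subseteq> set_mset m"
  then show "edge_monomial e \<subseteq># m"
    by (auto simp: edge_monomial_def subseteq_mset_def count_mset_set' Suc_le_eq)
qed

text \<open>A squarefree monomial divides \<open>m\<close> as soon as each of its variables does, so both sides divide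
  the same monomials.\<close>

lemma label_eq_mset_set_Union:
  assumes "finite \<sigma>" and "\<And>e. e \<in> \<sigma> \<Longrightarrow> finite e"
  shows "label \<sigma> = mset_set (\<Union>\<sigma>)"
proof -
  have "label \<sigma> \<subseteq># m \<longleftrightarrow> mset_set (\<Union>\<sigma>) \<subseteq># m" for m
  proof -
    have "label \<sigma> \<subseteq># m \<longleftrightarrow> \<Union>\<sigma> \<subseteq> set_mset m"
      using assms by (simp add: label_dvd_iff edge_monomial_dvd_iff Sup_le_iff)
    also have "\<dots> \<longleftrightarrow> mset_set (\<Union>\<sigma>) \<subseteq># m"
      using assms edge_monomial_dvd_iff[of "\<Union>\<sigma>" m] by (simp add: edge_monomial_def)
    finally show ?thesis .
  qed
  from this[of "label \<sigma>"] this[of "mset_set (\<Union>\<sigma>)"] show ?thesis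
    by (simp add: subset_mset.eq_iff)
qed

lemma edge_cases:
  assumes "finite_simple_graph G" and "e \<in> edges G"
  obtains x y where "e = {x, y}" "x \<noteq> y" "x \<in> verts G" "y \<in> verts G"
  using assms by (auto simp: finite_simple_graph_def card_2_iff)

lemma finite_edges:
  assumes "finite_simple_graph G"
  shows "finite (edges G)"
  using assms unfolding finite_simple_graph_def
  by (meson PowI finite_Pow_iff finite_subset subsetI)

lemma label_eq_iff:
  assumes "finite_simple_graph G" and "\<sigma> \<subseteq> edges G" and "\<tau> \<subseteq> edges G"
  shows "label \<sigma> = label \<tau> \<longleftrightarrow> \<Union>\<sigma> = \<Union>\<tau>"
proof -
  have *: "finite \<rho> \<and> (\<forall>e \<in> \<rho>. finite e)" if "\<rho> \<subseteq> edges G" for \<rho>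
    using that assms(1) finite_edges[OF assms(1)]
    by (metis edge_cases finite.emptyI finite.insertI finite_subset subsetD)
  show ?thesis
    using *[OF assms(2)] *[OF assms(3)]
    by (simp add: label_eq_mset_set_Union mset_set_eq_iff)
qed

text \<open>Paths of length 0 and 1 are single vertices and single edges, so this removes paths from the
  argument. It also shows that being at distance 1 is symmetric.\<close>

lemma edge_dist_eq_1_iff:
  assumes G: "finite_simple_graph G" and e: "e \<in> edges G" and e': "e' \<in> edges G"
  shows "edge_dist G e e' = 1 \<longleftrightarrow> e \<inter> e' = {} \<and> (\<exists>x \<in> e. \<exists>y \<in> e'. {x, y} \<in> edges G)"
    (is "_ \<longleftrightarrow> ?R")
proof -
  define L where "L = {enat (length p - 1) | p. is_path G p \<and> hd p \<in> e \<and> last p \<in> e'}"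
  have dist: "edge_dist G e e' = Inf L"
    by (simp add: edge_dist_def L_def)
  have 0: "0 \<in> L" if x: "x \<in> e" "x \<in> e'" for x
  proof -
    have "is_path G [x]"
      using G e x by (auto simp: is_path_def finite_simple_graph_def)
    then show ?thesis
      using x unfolding L_def by (force simp: zero_enat_def)
  qed
  have 1: "1 \<in> L" if x: "x \<in> e" and y: "y \<in> e'" and xy: "{x, y} \<in> edges G" for x y
  proof -
    have "is_path G [x, y]"
      using G edge_cases[OF G xy] xy by (auto simp: is_path_def doubleton_eq_iff)
    then show ?thesis
      using x y unfolding L_def by (force simp: one_enat_def)
  qed
  show ?thesis
  proof
    assume eq: "edge_dist G e e' = 1"
    have "e \<inter> e' = {}"
    proof (rule ccontr)
      assume "e \<inter> e' \<noteq> {}"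
      then have "Inf L \<le> 0"
        using 0 by (blast intro: Inf_lower)
      then show False
        using eq dist by simp
    qed
    \<comment> \<open>The infimum is finite, so it is attained.\<close>
    have "1 \<in> L"
      using eq dist by (metis Inf_enat_def LeastI ex_in_conv infinity_ne_i1)
    then obtain p where p: "is_path G p" "hd p \<in> e" "last p \<in> e'" "length p - 1 = 1"
      unfolding L_def by (auto simp: one_enat_def)
    then obtain x y where "p = [x, y]"
      by (metis One_nat_def Suc_1 Suc_diff_1 add_diff_cancel_left' diff_0_eq_0 gr0I
          length_0_conv length_Suc_conv zero_neq_one)
    with p \<open>e \<inter> e' = {}\<close> show ?R
      by (auto simp: is_path_def)
  next
    assume R: ?R
    have "0 \<notin> L"
    proof
      assume "0 \<in> L"
      then obtain p where "p \<noteq> []" "hd p \<in> e" "last p \<in> e'" "length p - 1 = 0"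
        unfolding L_def by (auto simp: zero_enat_def is_path_def)
      then show False
        using R by (cases p) auto
    qed
    then have "1 \<le> Inf L"
      by (metis Inf_greatest ileI1 i0_lb one_eSuc order_le_less)
    moreover have "Inf L \<le> 1"
      using R 1 by (blast intro: Inf_lower)
    ultimately show "edge_dist G e e' = 1"
      using dist by simp
  qed
qed

lemma forest_triangle_free:
  assumes "forest G" and "{x, y} \<in> edges G" "{y, z} \<in> edges G" "{z, x} \<in> edges G"
  shows False
proof -
  have G: "finite_simple_graph G"
    using assms(1) by (simp add: forest_def)
  have "is_cycle G [x, y, z]"
    using assms(2-4) edge_cases[OF G assms(2)] edge_cases[OF G assms(3)] edge_cases[OF G assms(4)]
    by (auto simp: is_cycle_def is_path_def nth_Cons' less_Suc_eq doubleton_eq_iff)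
  then show False
    using assms(1) by (auto simp: forest_def)
qed

text \<open>The edge \<open>f\<close> itself is the path of length 1, between an edge of \<open>\<rho>\<close> covering one end and an
  edge of \<open>\<rho>\<close> covering the other. No single edge of \<open>\<rho>\<close> covers both, as \<open>f \<notin> \<rho>\<close>, and the two
  cannot share their far ends, as there is no triangle.\<close>

lemma redundant_edge_imp_dist_1:
  assumes "forest G" and \<rho>: "\<rho> \<subseteq> edges G"
    and f: "f \<in> edges G" "f \<notin> \<rho>" "f \<subseteq> \<Union>\<rho>"
  obtains e e' where "e \<in> \<rho>" "e' \<in> \<rho>" "edge_dist G e e' = 1"
proof -
  have G: "finite_simple_graph G"
    using assms(1) by (simp add: forest_def)
  obtain b c where bc: "f = {b, c}" "b \<noteq> c"
    using edge_cases[OF G f(1)] by metis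
  then obtain e e' where e: "e \<in> \<rho>" "b \<in> e" and e': "e' \<in> \<rho>" "c \<in> e'"
    using f(3) by auto
  obtain a where a: "e = {b, a}"
    using edge_cases[OF G, of e] e \<rho> by (metis insert_commute insert_iff singletonD subsetD)
  obtain d where d: "e' = {c, d}"
    using edge_cases[OF G, of e'] e' \<rho> by (metis insert_commute insert_iff singletonD subsetD)
  have "a \<noteq> c" "d \<noteq> b"
    using a d e e' bc f(2) by (auto simp: insert_commute)
  moreover have "a \<noteq> d"
    using forest_triangle_free[OF assms(1), of b c a] a d e e' bc f(1) \<rho>
    by (metis insert_commute subsetD)
  ultimately have "e \<inter> e' = {}"
    using a d bc(2) by auto
  then have "edge_dist G e e' = 1"
    using edge_dist_eq_1_iff[OF G, of e e'] e e' bc f(1) \<rho> by blast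
  then show thesis
    using that e e' by blast
qed

lemma Scarf_iff_no_dist_1:
  assumes "forest G"
  shows "\<sigma> \<in> Scarf G \<longleftrightarrow> \<sigma> \<subseteq> edges G \<and> (\<forall>e \<in> \<sigma>. \<forall>e' \<in> \<sigma>. edge_dist G e e' \<noteq> 1)"
proof (intro iffI conjI ballI notI)
  assume "\<sigma> \<in> Scarf G"
  then show "\<sigma> \<subseteq> edges G"
    by (simp add: Scarf_def Taylor_def)
next
  have G: "finite_simple_graph G"
    using assms by (simp add: forest_def)
  fix e e'
  assume Scarf: "\<sigma> \<in> Scarf G" and e: "e \<in> \<sigma>" and e': "e' \<in> \<sigma>" and dist: "edge_dist G e e' = 1"
  have \<sigma>: "\<sigma> \<subseteq> edges G"
    using Scarf by (simp add: Scarf_def Taylor_def)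
  obtain x y where disj: "e \<inter> e' = {}" and x: "x \<in> e" and y: "y \<in> e'" and f: "{x, y} \<in> edges G"
    using dist edge_dist_eq_1_iff[OF G, of e e'] e e' \<sigma> by blast
  \<comment> \<open>Toggle the connecting edge; its ends stay covered by \<open>e\<close> and \<open>e'\<close>, which are other edges.\<close>
  define \<tau> where "\<tau> = (if {x, y} \<in> \<sigma> then \<sigma> - {{x, y}} else insert {x, y} \<sigma>)"
  have "\<tau> \<subseteq> edges G" and "\<tau> \<noteq> \<sigma>"
    using \<sigma> f by (auto simp: \<tau>_def)
  moreover have "e \<in> \<tau>" "e' \<in> \<tau>"
    using e e' x y disj by (auto simp: \<tau>_def)
  then have "{x, y} \<subseteq> \<Union>\<tau>"
    using x y by blast
  then have "\<Union>\<tau> = \<Union>\<sigma>"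
    using x y e e' unfolding \<tau>_def by (cases "{x, y} \<in> \<sigma>") (simp; blast)+
  ultimately show False
    using Scarf label_eq_iff[OF G _ \<sigma>, of \<tau>] by (simp add: Scarf_def Taylor_def)
next
  have G: "finite_simple_graph G"
    using assms by (simp add: forest_def)
  assume *: "\<sigma> \<subseteq> edges G \<and> (\<forall>e \<in> \<sigma>. \<forall>e' \<in> \<sigma>. edge_dist G e e' \<noteq> 1)"
  have "\<tau> = \<sigma>" if \<tau>: "\<tau> \<subseteq> edges G" and "label \<tau> = label \<sigma>" for \<tau>
  proof -
    have cover: "\<Union>\<tau> = \<Union>\<sigma>"
      using label_eq_iff[OF G \<tau>] * that by blast
    have "\<tau> \<subseteq> \<sigma>"
    proof
      fix f assume f: "f \<in> \<tau>"
      show "f \<in> \<sigma>"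
      proof (rule ccontr)
        assume "f \<notin> \<sigma>"
        moreover have "f \<in> edges G" and "f \<subseteq> \<Union>\<sigma>"
          using f * \<tau> cover by blast+
        ultimately obtain e e' where "e \<in> \<sigma>" "e' \<in> \<sigma>" "edge_dist G e e' = 1"
          using redundant_edge_imp_dist_1[OF assms, of \<sigma> f] * \<tau> by metis
        then show False
          using * by blast
      qed
    qed
    moreover have "\<sigma> \<subseteq> \<tau>"
    proof
      fix f assume f: "f \<in> \<sigma>"
      show "f \<in> \<tau>"
      proof (rule ccontr)
        assume "f \<notin> \<tau>"
        moreover have "f \<in> edges G" and "f \<subseteq> \<Union>\<tau>"
          using f * \<tau> cover by blast+
        ultimately obtain e e' where "e \<in> \<tau>" "e' \<in> \<tau>" "edge_dist G e e' = 1"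
          using redundant_edge_imp_dist_1[OF assms, of \<tau> f] * \<tau> by metis
        then show False
          using * \<open>\<tau> \<subseteq> \<sigma>\<close> by blast
      qed
    qed
    ultimately show ?thesis ..
  qed
  then show "\<sigma> \<in> Scarf G"
    using * by (simp add: Scarf_def Taylor_def)
qed

theorem theorem6p4:
  fixes G :: "'v graph"
  assumes "forest G"
  shows "let K = complete_graph (edges G);
             K' = remove_edges K
               {{e, e'} | e e'. e \<in> edges G \<and> e' \<in> edges G \<and> edge_dist G e e' = 1}
         in Scarf G = clique_complex K'"
proof -
  have G: "finite_simple_graph G"
    using assms by (simp add: forest_def)
  define F where "F = {{e, e'} | e e'. e \<in> edges G \<and> e' \<in> edges G \<and> edge_dist G e e' = 1}"
  define K' where "K' = remove_edges (complete_graph (edges G)) F"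
  have sym: "edge_dist G e e' = 1 \<longleftrightarrow> edge_dist G e' e = 1"
    if "e \<in> edges G" "e' \<in> edges G" for e e'
    using that by (simp add: edge_dist_eq_1_iff[OF G] Int_commute) (metis insert_commute)
  have irrefl: "edge_dist G e e \<noteq> 1" if "e \<in> edges G" for e
    using that edge_cases[OF G that] by (auto simp: edge_dist_eq_1_iff[OF G])
  have F: "{e, e'} \<in> F \<longleftrightarrow> edge_dist G e e' = 1" if "e \<in> edges G" "e' \<in> edges G" for e e'
    using that sym[OF that] unfolding F_def by (auto simp: doubleton_eq_iff)
  have "\<sigma> \<in> clique_complex K' \<longleftrightarrow> \<sigma> \<in> Scarf G" for \<sigma>
  proof -
    have "\<sigma> \<in> clique_complex K' \<longleftrightarrow>
        \<sigma> \<subseteq> edges G \<and> (\<forall>e \<in> \<sigma>. \<forall>e' \<in> \<sigma>. e \<noteq> e' \<longrightarrow> {e, e'} \<notin> F)"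
      using finite_subset[OF _ finite_edges[OF G]]
      by (auto simp: clique_complex_def K'_def remove_edges_def complete_graph_def)
    also have "\<dots> \<longleftrightarrow> \<sigma> \<subseteq> edges G \<and> (\<forall>e \<in> \<sigma>. \<forall>e' \<in> \<sigma>. edge_dist G e e' \<noteq> 1)"
      using F irrefl by (metis subsetD)
    also have "\<dots> \<longleftrightarrow> \<sigma> \<in> Scarf G"
      using Scarf_iff_no_dist_1[OF assms] by simp
    finally show ?thesis .
  qed
  then show ?thesis
    unfolding K'_def F_def Let_def by blast
qed

end
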